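(* Let $(X_1,\dots,X_n)$ be an exchangeable occupancy model on $A_{n,r}$ and let $(X'_1,\dots,X'_n)$ be the occupancy numbers obtained by applying the transformation $\mathcal{K}_1$ (dropping one of the $r$ particles uniformly at random). Then $(X'_1,\dots,X'_n)$ is an exchangeable occupancy model on $A_{n,r-1}$.
   Context: For integers $n\ge1$, $r\ge0$, $A_{n,r}$ is the set of vectors $(x_1,\dots,x_n)$ of non-negative integers with $\sum_{j=1}^n x_j=r$; here $n\ge2$, $r\ge1$. An occupancy model on $A_{n,r}$ is a probability distribution on $A_{n,r}$ (equivalently, the law of a random vector $(X_1,\dots,X_n)$ with values in $A_{n,r}$; $X_j$ counts the particles in cell $j$ when $r$ particles are distributed among $n$ cells). It is an exchangeable occupancy model if $(X_1,\dots,X_n)$ is exchangeable, i.e. its law is invariant under all permutations of the coordinates. Transformation $\mathcal{K}_1$: given $(X_1,\dots,X_n)$, one of the $r$ particles is dropped at random, each of the $r$ particles having the same probability $1/r$ of being dropped independently of its cell; $(X'_1,\dots,X'_n)$ are the occupancy numbers of the remaining $r-1$ particles. That is, conditionally on $(X_1,\dots,X_n)=(x_1,\dots,x_n)$, for each $h$, with probability $x_h/r$ one has $X'_h=x_h-1$ and $X'_j=x_j$ for $j\ne h$. *)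

theory Defs
  imports "HOL-Probability.Probability_Mass_Function" "HOL-Combinatorics.Permutations"
begin

text \<open>A vector $(x_1,\dots,x_n)$ is a function on \<open>nat\<close> that vanishes outside \<open>{1..n}\<close>,
  so that distinct functions are distinct vectors.\<close>

definition occ_vectors :: "nat \<Rightarrow> nat \<Rightarrow> (nat \<Rightarrow> nat) set" where
  "occ_vectors n r = {x. (\<forall>j. j \<notin> {1..n} \<longrightarrow> x j = 0) \<and> (\<Sum>j=1..n. x j) = r}"

definition occupancy_model :: "nat \<Rightarrow> nat \<Rightarrow> (nat \<Rightarrow> nat) pmf \<Rightarrow> bool" where
  "occupancy_model n r p \<longleftrightarrow> set_pmf p \<subseteq> occ_vectors n r"

definition exchangeable :: "nat \<Rightarrow> (nat \<Rightarrow> nat) pmf \<Rightarrow> bool" where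
  "exchangeable n p \<longleftrightarrow> (\<forall>\<sigma>. \<sigma> permutes {1..n} \<longrightarrow> map_pmf (\<lambda>x. x \<circ> \<sigma>) p = p)"

definition exchangeable_occupancy_model :: "nat \<Rightarrow> nat \<Rightarrow> (nat \<Rightarrow> nat) pmf \<Rightarrow> bool" where
  "exchangeable_occupancy_model n r p \<longleftrightarrow> occupancy_model n r p \<and> exchangeable n p"

text \<open>The particle \<open>(h, i)\<close> is the \<open>i\<close>-th of the \<open>x h\<close> particles in cell \<open>h\<close>.\<close>

definition particles :: "nat \<Rightarrow> (nat \<Rightarrow> nat) \<Rightarrow> (nat \<times> nat) set" where
  "particles n x = (SIGMA h:{1..n}. {..<x h})"

text \<open>The law of the cell of a uniformly chosen particle. It is meaningful only if there is at
  least one particle, because \<open>pmf_of_set {}\<close> is unspecified.\<close>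

definition dropped_cell :: "nat \<Rightarrow> (nat \<Rightarrow> nat) \<Rightarrow> nat pmf" where
  "dropped_cell n x = map_pmf fst (pmf_of_set (particles n x))"

definition drop_particle :: "nat \<Rightarrow> (nat \<Rightarrow> nat) \<Rightarrow> (nat \<Rightarrow> nat) pmf" where
  "drop_particle n x = map_pmf (\<lambda>h. x(h := x h - 1)) (dropped_cell n x)"

text \<open>The law of $(X'_1,\dots,X'_n)$ when $(X_1,\dots,X_n)$ has law \<open>p\<close>; \<open>drop_particle n x\<close>
  is its conditional law given $(X_1,\dots,X_n) = x$.\<close>

definition K1 :: "nat \<Rightarrow> (nat \<Rightarrow> nat) pmf \<Rightarrow> (nat \<Rightarrow> nat) pmf" where
  "K1 n p = bind_pmf p (drop_particle n)"

lemma finite_particles: "finite (particles n x)"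
  by (simp add: particles_def)

lemma card_particles: "x \<in> occ_vectors n r \<Longrightarrow> card (particles n x) = r"
  by (simp add: particles_def occ_vectors_def)

lemma pmf_dropped_cell:
  assumes x: "x \<in> occ_vectors n r" and r: "r \<ge> 1"
  shows "pmf (dropped_cell n x) h = real (x h) / real r"
proof -
  have ne: "particles n x \<noteq> {}"
    using card_particles[OF x] r by auto
  have eq: "particles n x \<inter> fst -` {h} = (if h \<in> {1..n} then {h} \<times> {..<x h} else {})"
    by (auto simp: particles_def)
  have "card (particles n x \<inter> fst -` {h}) = x h"
    unfolding eq using x by (auto simp: occ_vectors_def card_cartesian_product)
  then show ?thesis
    using ne finite_particles[of n x] card_particles[OF x]
    by (simp add: dropped_cell_def pmf_map measure_pmf_of_set)
qed

lemma pmf_drop_particle: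
  assumes x: "x \<in> occ_vectors n r" and r: "r \<ge> 1" and h: "x h \<ge> 1"
  shows "pmf (drop_particle n x) (x(h := x h - 1)) = real (x h) / real r"
proof -
  have pos: "x k \<ge> 1" if "k \<in> set_pmf (dropped_cell n x)" for k
    using that pmf_dropped_cell[OF x r, of k] by (cases "x k") (auto simp: set_pmf_iff)
  have inj: "inj_on (\<lambda>k. x(k := x k - 1)) {k. x k \<ge> 1}"
  proof (rule inj_onI)
    fix k l assume k: "k \<in> {k. x k \<ge> 1}" and e: "x(k := x k - 1) = x(l := x l - 1)"
    show "k = l" using fun_cong[OF e, of k] k by (auto split: if_splits)
  qed
  have "h \<in> set_pmf (dropped_cell n x)"
    using pmf_dropped_cell[OF x r, of h] h r by (simp add: set_pmf_iff)
  then have "pmf (drop_particle n x) (x(h := x h - 1)) = pmf (dropped_cell n x) h"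
    unfolding drop_particle_def
    by (intro pmf_map_inj inj_on_subset[OF inj]) (use pos in auto)
  then show ?thesis using pmf_dropped_cell[OF x r] by simp
qed

end

theory Submission imports Defs begin

text \<open>Relabelling the cells by a permutation commutes with dropping a particle, because the cell of
  the dropped particle has law \<^term>\<open>\<lambda>h. real (x h) / real r\<close>, which is relabelled along with
  \<^term>\<open>x\<close>. Averaging over the exchangeable law of \<^term>\<open>x\<close> gives the exchangeability
  of the new model.\<close>

lemma occ_vectors_comp_permutes:
  assumes "x \<in> occ_vectors n r" and \<sigma>: "\<sigma> permutes {1..n}"
  shows "x \<circ> \<sigma> \<in> occ_vectors n r"
  using assms sum.permute[OF \<sigma>, of x] permutes_not_in[OF \<sigma>] by (auto simp: occ_vectors_def)

text \<open>An empty cell \<open>h\<close> is hit with probability \<open>x h / r = 0\<close>. This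
  keeps the truncated subtraction in \<open>drop_particle\<close> from leaving \<open>x\<close>
  unchanged.\<close>

lemma dropped_cell_pos:
  assumes "x \<in> occ_vectors n r" and "r \<ge> 1" and "h \<in> set_pmf (dropped_cell n x)"
  shows "x h \<ge> 1"
  using assms(3) pmf_dropped_cell[OF assms(1,2), of h] by (cases "x h") (auto simp: set_pmf_iff)

text \<open>Positivity of \<open>x h\<close> forces \<open>h\<close> into \<open>{1..n}\<close>,
  since \<open>x\<close> vanishes elsewhere, and makes the subtraction on \<open>nat\<close> lower
  the total by exactly one.\<close>

lemma occ_vectors_remove_particle:
  assumes x: "x \<in> occ_vectors n r" and h: "x h \<ge> 1"
  shows "x(h := x h - 1) \<in> occ_vectors n (r - 1)"
proof -
  have mem: "h \<in> {1..n}" using x h by (fastforce simp: occ_vectors_def)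
  have "(\<Sum>j\<in>{1..n} - {h}. (x(h := x h - 1)) j) = (\<Sum>j\<in>{1..n} - {h}. x j)"
    by (rule sum.cong) auto
  then have "(\<Sum>j=1..n. (x(h := x h - 1)) j) = r - 1"
    using x h sum.remove[OF finite_atLeastAtMost mem, of x]
      sum.remove[OF finite_atLeastAtMost mem, of "x(h := x h - 1)"]
    by (simp add: occ_vectors_def)
  then show ?thesis using x by (auto simp: occ_vectors_def)
qed

lemma set_pmf_drop_particle:
  assumes "x \<in> occ_vectors n r" and "r \<ge> 1"
  shows "set_pmf (drop_particle n x) \<subseteq> occ_vectors n (r - 1)"
  using occ_vectors_remove_particle[OF assms(1)] dropped_cell_pos[OF assms]
  by (auto simp: drop_particle_def)

text \<open>Cell \<open>h\<close> of \<open>x \<circ> \<sigma>\<close> is cell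
  \<open>\<sigma> h\<close> of \<open>x\<close>, so labels of cells move by
  \<open>inv \<sigma>\<close>. Both sides give \<open>h\<close> the mass
  \<open>x (\<sigma> h) / r\<close>.\<close>

lemma dropped_cell_comp_permutes:
  assumes x: "x \<in> occ_vectors n r" and r: "r \<ge> 1" and \<sigma>: "\<sigma> permutes {1..n}"
  shows "dropped_cell n (x \<circ> \<sigma>) = map_pmf (inv \<sigma>) (dropped_cell n x)"
proof (rule pmf_eqI)
  fix h
  \<comment> \<open>Writing \<open>h\<close> as \<open>inv \<sigma> (\<sigma> h)\<close> exhibits it
    as an image under the injective map \<open>inv \<sigma>\<close>.\<close>
  have "pmf (map_pmf (inv \<sigma>) (dropped_cell n x)) (inv \<sigma> (\<sigma> h)) = pmf (dropped_cell n x) (\<sigma> h)"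
    by (rule pmf_map_inj') (rule permutes_inj[OF permutes_inv[OF \<sigma>]])
  then show "pmf (dropped_cell n (x \<circ> \<sigma>)) h = pmf (map_pmf (inv \<sigma>) (dropped_cell n x)) h"
    by (simp add: permutes_inverses[OF \<sigma>] pmf_dropped_cell[OF x r]
        pmf_dropped_cell[OF occ_vectors_comp_permutes[OF x \<sigma>] r])
qed

lemma drop_particle_comp_permutes:
  assumes x: "x \<in> occ_vectors n r" and r: "r \<ge> 1" and \<sigma>: "\<sigma> permutes {1..n}"
  shows "drop_particle n (x \<circ> \<sigma>) = map_pmf (\<lambda>y. y \<circ> \<sigma>) (drop_particle n x)"
proof -
  \<comment> \<open>Both sides differ from \<open>x \<circ> \<sigma>\<close> at most at the one
    index that \<open>\<sigma>\<close> sends to \<open>k\<close>. Empty cells are covered, as both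
    subtractions truncate alike.\<close>
  have "(x \<circ> \<sigma>)(inv \<sigma> k := (x \<circ> \<sigma>) (inv \<sigma> k) - 1) = x(k := x k - 1) \<circ> \<sigma>" for k
    by (auto simp: fun_eq_iff permutes_inverses[OF \<sigma>])
  then show ?thesis
    unfolding drop_particle_def dropped_cell_comp_permutes[OF assms] pmf.map_comp
    by (intro map_pmf_cong refl) simp
qed

lemma occupancy_model_K1:
  assumes "occupancy_model n r p" and "r \<ge> 1"
  shows "occupancy_model n (r - 1) (K1 n p)"
  using assms set_pmf_drop_particle[of _ n r] by (fastforce simp: occupancy_model_def K1_def)

lemma exchangeable_K1:
  assumes p: "occupancy_model n r p" and r: "r \<ge> 1" and ex: "exchangeable n p"
  shows "exchangeable n (K1 n p)"
  unfolding exchangeable_def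
proof (intro allI impI)
  fix \<sigma> assume \<sigma>: "\<sigma> permutes {1..n}"
  have "map_pmf (\<lambda>x. x \<circ> \<sigma>) (K1 n p)
      = bind_pmf p (\<lambda>x. map_pmf (\<lambda>y. y \<circ> \<sigma>) (drop_particle n x))"
    by (simp add: K1_def map_bind_pmf)
  \<comment> \<open>Commutation is known only on \<open>occ_vectors n r\<close>, which contains the
    support of \<open>p\<close>.\<close>
  also have "\<dots> = bind_pmf p (\<lambda>x. drop_particle n (x \<circ> \<sigma>))"
    using p drop_particle_comp_permutes[OF _ r \<sigma>]
    by (intro bind_pmf_cong refl) (auto simp: occupancy_model_def)
  also have "\<dots> = K1 n (map_pmf (\<lambda>x. x \<circ> \<sigma>) p)"
    by (simp add: K1_def bind_map_pmf)
  also have "\<dots> = K1 n p"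
    using ex \<sigma> by (simp add: exchangeable_def)
  finally show "map_pmf (\<lambda>x. x \<circ> \<sigma>) (K1 n p) = K1 n p" .
qed

theorem proposition6p3:
  fixes n r :: nat and p :: "(nat \<Rightarrow> nat) pmf"
  assumes "n \<ge> 2" and "r \<ge> 1"
    and "exchangeable_occupancy_model n r p"
  shows "exchangeable_occupancy_model n (r - 1) (K1 n p)"
  using assms occupancy_model_K1 exchangeable_K1
  by (auto simp: exchangeable_occupancy_model_def)

end
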